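(* Let $a=(a_n)_{n=0}^\infty$ with $a_n=2^n$ (the binary numeral system), and let $d=(d_n)_{n=0}^\infty$ with $d_n=2^{n+1}$. Then $d$ is a divisor system for $a$, and for every integer $n\geq1$ and $$q:=(1,2,4,8,\ldots,2^{n-1}),$$ the simplex $\Delta_{(1,q)}\subset\mathbb{R}^n$ is reflexive and has $h^\ast$-polynomial $$h^\ast(\Delta_{(1,q)};z)=\sum_{b=0}^{2^n-1}z^{\mathrm{supp}_2(b)}=(1+z)^n.$$
   Context: A numeral system is a sequence of positive integers $a=(a_n)_{n=0}^\infty$ with $a_0=1<a_1<a_2<\cdots$. A divisor system for $a$ is an increasing sequence of positive integers $d=(d_n)_{n=0}^\infty$ such that (1) $d_i\mid a_n$ for all $n\geq1$ and $0\leq i\leq n-1$, and (2) $1+\sum_{i=0}^{n-1}\frac{a_n}{d_i}=a_n$ for all $n\geq 1$. For an integer $b\geq0$, $\mathrm{supp}_2(b)$ is the number of nonzero digits in the binary representation of $b$. For a weakly increasing sequence $q=(q_1,\ldots,q_n)$ of positive integers, $\Delta_{(1,q)}:=\mathrm{conv}(e_1,\ldots,e_n,-q)\subset\mathbb{R}^n$, where $e_1,\ldots,e_n$ are the standard basis vectors. A lattice polytope $P\subset\mathbb{R}^n$ (all vertices in $\mathbb{Z}^n$) is reflexive if its polar body $P^\circ=\{y\in\mathbb{R}^n: y^Tx\leq 1\text{ for all }x\in P\}$ is also a lattice polytope. For a $d$-dimensional lattice polytope $P\subset\mathbb{R}^n$, the $h^\ast$-polynomial $h^\ast(P;z)=h_0^\ast+h_1^\ast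 z+\cdots+h_d^\ast z^d$ is defined by $\sum_{t\geq0}|tP\cap\mathbb{Z}^n|z^t=\frac{h^\ast(P;z)}{(1-z)^{d+1}}$. *)

theory Defs
  imports "HOL-Analysis.Analysis" "HOL-Computational_Algebra.Computational_Algebra"
begin

definition numeral_system :: "(nat \<Rightarrow> nat) \<Rightarrow> bool" where
  "numeral_system a \<longleftrightarrow> a 0 = 1 \<and> strict_mono a"

definition divisor_system :: "(nat \<Rightarrow> nat) \<Rightarrow> (nat \<Rightarrow> nat) \<Rightarrow> bool" where
  "divisor_system a d \<longleftrightarrow>
     (\<forall>n. d n > 0) \<and> strict_mono d \<and>
     (\<forall>n\<ge>1. \<forall>i<n. d i dvd a n) \<and>
     (\<forall>n\<ge>1. 1 + (\<Sum>i<n. real (a n) / real (d i)) = real (a n))"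

definition supp2 :: "nat \<Rightarrow> nat" where
  "supp2 b = card {k. bit b k}"

definition int_lattice :: "(real ^ 'n) set" where
  "int_lattice = {x. \<forall>i. x $ i \<in> \<int>}"

definition lattice_polytope :: "(real ^ 'n) set \<Rightarrow> bool" where
  "lattice_polytope P \<longleftrightarrow> polytope P \<and> {v. v extreme_point_of P} \<subseteq> int_lattice"

definition polar_body :: "(real ^ 'n) set \<Rightarrow> (real ^ 'n) set" where
  "polar_body P = {y. \<forall>x\<in>P. y \<bullet> x \<le> 1}"

text \<open>The polar body need not be bounded. Since \<^const>\<open>lattice_polytope\<close> asks for a polytope, a
  reflexive polytope is automatically full-dimensional with the origin in its interior.\<close>

definition reflexive_polytope :: "(real ^ 'n) set \<Rightarrow> bool" where
  "reflexive_polytope P \<longleftrightarrow> lattice_polytope P \<and> lattice_polytope (polar_body P)"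

definition ehrhart_series :: "(real ^ 'n) set \<Rightarrow> real fps" where
  "ehrhart_series P = Abs_fps (\<lambda>t. real (card ((\<lambda>x. real t *\<^sub>R x) ` P \<inter> int_lattice)))"

text \<open>The polynomial \<open>h\<^sup>*(P; z)\<close> is introduced as a relation rather than by a description operator,
  so that its existence is part of any claim about it. The polytope is required to be nonempty, so
  that its dimension is a natural number.\<close>

definition has_hstar_polynomial :: "(real ^ 'n) set \<Rightarrow> real poly \<Rightarrow> bool" where
  "has_hstar_polynomial P h \<longleftrightarrow>
     lattice_polytope P \<and> P \<noteq> {} \<and> degree h \<le> nat (aff_dim P) \<and>
     ehrhart_series P = fps_of_poly h / (1 - fps_X) ^ (nat (aff_dim P) + 1)"

lemma has_hstar_polynomial_unique:
  assumes "has_hstar_polynomial P g" and "has_hstar_polynomial P h"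
  shows "g = h"
proof -
  define U :: "real fps" where "U = (1 - fps_X) ^ (nat (aff_dim P) + 1)"
  have U0: "fps_nth U 0 \<noteq> 0"
    by (simp add: U_def fps_power_zeroth)
  have "fps_of_poly g / U = fps_of_poly h / U"
    using assms by (simp add: has_hstar_polynomial_def U_def)
  then have "fps_of_poly g * inverse U * U = fps_of_poly h * inverse U * U"
    using U0 by (simp add: fps_divide_unit)
  then have "fps_of_poly g = fps_of_poly h"
    using U0 by (simp add: mult.assoc inverse_mult_eq_1)
  then show ?thesis
    by simp
qed

text \<open>The simplex \<open>\<Delta>\<^bsub>(1,q)\<^esub>\<close>, with \<open>q\<close> indexed by the coordinates of the ambient space.\<close>

definition simplex_1q :: "nat ^ 'n \<Rightarrow> (real ^ 'n) set" where
  "simplex_1q q = convex hull (insert (- (\<chi> i. real (q $ i))) (range (\<lambda>i. axis i 1)))"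

end

theory Submission
  imports Defs
begin

text \<open>
  Write \<open>N = 2\<^sup>n\<close>. The polar of the simplex is the simplex with vertices \<open>1\<close> and
  \<open>1 - (N / q\<^sub>i) e\<^sub>i\<close>, which are lattice points because \<open>q\<^sub>i\<close> divides \<open>N\<close>.

  A lattice point \<open>x\<close> lies in the \<open>t\<close>-th dilate iff \<open>m = t - \<Sum> x\<^sub>i\<close> is nonnegative and
  \<open>y\<^sub>i = x\<^sub>i + \<lfloor>q\<^sub>i m / N\<rfloor> \<ge> 0\<close> for all \<open>i\<close>. With \<open>m = N c + b\<close> and \<open>b < N\<close>, Legendre's formula
  \<open>\<Sum> \<lfloor>b / 2\<^sup>j\<rfloor> = b - supp\<^sub>2(b)\<close> turns the relation between \<open>m\<close> and \<open>x\<close> into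
  \<open>c + \<Sum> y\<^sub>i = t - supp\<^sub>2(b)\<close>. So every residue \<open>b\<close> contributes the coefficient of
  \<open>z\<^sup>t\<close> in \<open>z\<^bsup>supp(b)\<^esup> / (1 - z)\<^bsup>n+1\<^esup>\<close>.
\<close>

unbundle no Formal_Power_Series.fps_syntax

section \<open>Binary digits: Legendre's formula and the generating function of
  \<open>supp2\<close>\<close>

lemma supp2_mod_power: "supp2 (m mod 2 ^ n) = card {k. k < n \<and> bit m k}"
  by (simp add: supp2_def bit_take_bit_iff flip: take_bit_eq_mod)

text \<open>Truncated Legendre formula; \<open>m div 2 ^ n\<close> is the part of m not yet
  expanded. In the induction step this remainder splits as twice \<open>m div 2 ^ Suc n\<close> plus
  bit n: one copy joins the sum, one becomes the new remainder, and the bit joins the digit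
  sum.\<close>

lemma legendre_digits:
  "(\<Sum>j=1..n. m div 2 ^ j) + supp2 (m mod 2 ^ n) + m div 2 ^ n = m"
proof (induction n)
  case 0
  show ?case by (simp add: supp2_def)
next
  case (Suc n)
  have "{k. k < Suc n \<and> bit m k} = {k. k < n \<and> bit m k} \<union> (if bit m n then {n} else {})"
    by (auto simp: less_Suc_eq)
  then have supp: "supp2 (m mod 2 ^ Suc n) = supp2 (m mod 2 ^ n) + of_bool (bit m n)"
    unfolding supp2_mod_power by (auto simp: card_insert_if)
  have "m div 2 ^ n = 2 * (m div 2 ^ Suc n) + of_bool (bit m n)"
    unfolding power_Suc2 div_mult2_eq bit_iff_odd by (cases "even (m div 2 ^ n)") auto
  moreover have "(\<Sum>j=1..Suc n. m div 2 ^ j) = (\<Sum>j=1..n. m div 2 ^ j) + m div 2 ^ Suc n"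
    by (rule sum.cl_ivl_Suc[THEN trans]) simp
  ultimately show ?case
    using Suc supp by linarith
qed

lemma sum_powers_of_2: "Suc (\<Sum>j<n. 2 ^ j) = 2 ^ n"
  by (induction n) auto

text \<open>The numbers from 2^n up to 2^(n+1) - 1 are those below 2^n with bit n switched on. They
  contribute the same sum times z, so each step multiplies by 1 + z.\<close>

lemma sum_monom_supp2:
  "(\<Sum>b<2 ^ n. monom (1::real) (supp2 b)) = [:1, 1:] ^ n"
proof (induction n)
  case 0
  show ?case by (simp add: supp2_def one_poly_def monom_0)
next
  case (Suc n)
  have step: "supp2 (b + 2 ^ n) = Suc (supp2 b)" if "b < 2 ^ n" for b
  proof -
    have b: "take_bit n b = b"
      using that by (simp add: take_bit_nat_eq_self)
    have nb: "\<not> bit b n" and fin: "finite {k. bit b k}"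
      using bit_take_bit_iff[of n b] finite_subset[of "{k. bit b k}" "{..<n}"] by (auto simp: b)
    \<comment> \<open>Bit n of b is zero, so the addition produces no carry.\<close>
    have "b + 2 ^ n = set_bit n b"
      using nb by (simp add: set_bit_eq)
    then have "{k. bit (b + 2 ^ n) k} = insert n {k. bit b k}"
      by (auto simp: bit_set_bit_iff)
    then show ?thesis
      using nb fin by (simp add: supp2_def)
  qed
  have "{..<2 ^ Suc n} = {..<2 ^ n} \<union> (\<lambda>b. b + 2 ^ n) ` {..<(2::nat) ^ n}"
  proof (intro equalityI subsetI)
    fix b :: nat assume "b \<in> {..<2 ^ Suc n}"
    then have "b < 2 ^ n \<or> (b = (b - 2 ^ n) + 2 ^ n \<and> b - 2 ^ n < 2 ^ n)"
      unfolding lessThan_iff power_Suc by linarith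
    then show "b \<in> {..<2 ^ n} \<union> (\<lambda>b. b + 2 ^ n) ` {..<2 ^ n}"
      by blast
  qed auto
  then have "(\<Sum>b<2 ^ Suc n. monom (1::real) (supp2 b)) =
      (\<Sum>b<2 ^ n. monom 1 (supp2 b)) + (\<Sum>b\<in>(\<lambda>b. b + 2 ^ n) ` {..<2 ^ n}. monom 1 (supp2 b))"
    by (auto intro!: sum.union_disjoint)
  also have "(\<Sum>b\<in>(\<lambda>b. b + 2 ^ n) ` {..<2 ^ n}. monom (1::real) (supp2 b)) =
      (\<Sum>b<2 ^ n. monom 1 (supp2 (b + 2 ^ n)))"
    by (subst sum.reindex) auto
  also have "\<dots> = (\<Sum>b<2 ^ n. [:0, 1:] * monom 1 (supp2 b))"
    by (intro sum.cong) (auto simp: step monom_Suc)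
  also have "\<dots> = [:0, 1:] * [:1, 1:] ^ n"
    by (simp only: sum_distrib_left[symmetric] Suc)
  finally show ?case
    by (simp add: Suc)
qed

section \<open>Facets, dimension and polar body of the simplex\<close>

lemma convex_combination_insert:
  fixes w :: "'i::finite \<Rightarrow> 'a::real_vector"
  assumes "convex C" "v \<in> C" "\<And>i. w i \<in> C"
    and "0 \<le> c" "\<And>i. 0 \<le> l i" "c + (\<Sum>i\<in>UNIV. l i) = 1"
  shows "c *\<^sub>R v + (\<Sum>i\<in>UNIV. l i *\<^sub>R w i) \<in> C"
proof -
  \<comment> \<open>The index type is \<open>'i option\<close>: \<open>None\<close> carries the
    distinguished vertex v, \<open>Some i\<close> the vertex \<open>w i\<close>.\<close>
  have "(\<Sum>j\<in>UNIV. case_option c l j *\<^sub>R case_option v w j) \<in> C"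
    using assms by (intro convex_sum) (auto simp: UNIV_option_conv sum.reindex split: option.split)
  then show ?thesis
    by (simp add: UNIV_option_conv sum.reindex)
qed

lemma lattice_polytope_convex_hull:
  assumes "finite V" "V \<subseteq> int_lattice"
  shows "lattice_polytope (convex hull V)"
  using assms extreme_point_of_convex_hull
  by (auto simp: lattice_polytope_def polytope_convex_hull)

text \<open>The inequalities say that the barycentric coordinates are nonnegative. If x is c (-q)
  plus the sum of the l_i e_i, with total weight 1, then its coordinate sum is s = 1 - N c. Hence c
  = (1 - s) / N and l_i = x_i + q_i c.\<close>

lemma mem_simplex_1q_iff:
  fixes q :: "nat ^ 'n"
  defines "N \<equiv> 1 + (\<Sum>i\<in>UNIV. real (q $ i))"
  shows "x \<in> simplex_1q q \<longleftrightarrow>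
    (\<Sum>i\<in>UNIV. x $ i) \<le> 1 \<and> (\<forall>i. 0 \<le> N * x $ i + real (q $ i) * (1 - (\<Sum>i\<in>UNIV. x $ i)))"
    (is "_ \<longleftrightarrow> ?R x")
proof
  have N: "N \<ge> 1"
    by (simp add: N_def sum_nonneg)
  let ?C = "{x. ?R x}"
  have ax: "(\<Sum>i\<in>UNIV. axis j (1::real) $ i) = 1" for j :: 'n
    by (simp add: axis_def)
  have "convex ?C"
  proof -
    \<comment> \<open>Collecting the coefficients of each coordinate exhibits the condition for i as
      a half-space.\<close>
    have "(\<Sum>k\<in>UNIV. (real (q $ i) - (if k = i then N else 0)) * x $ k) =
        real (q $ i) * (\<Sum>k\<in>UNIV. x $ k) - N * x $ i" for x :: "real ^ 'n" and i
      by (simp add: left_diff_distrib sum_subtractf if_distrib [of "\<lambda>u. u * _"]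
          sum_distrib_left cong: if_cong)
    then have "0 \<le> N * x $ i + real (q $ i) * (1 - (\<Sum>k\<in>UNIV. x $ k)) \<longleftrightarrow>
        (\<Sum>k\<in>UNIV. (real (q $ i) - (if k = i then N else 0)) * x $ k) \<le> real (q $ i)"
      for x :: "real ^ 'n" and i
      by (simp only: right_diff_distrib) linarith
    then have "?C = {x. (\<Sum>i\<in>UNIV. x $ i) \<le> 1} \<inter>
        (\<Inter>i. {x. (\<Sum>k\<in>UNIV. (real (q $ i) - (if k = i then N else 0)) * x $ k) \<le> real (q $ i)})"
      by (simp only:) blast
    moreover have halfspace: "convex {x :: real ^ 'n. (\<Sum>k\<in>UNIV. a k * x $ k) \<le> b}" for a :: "'n \<Rightarrow> real" and b
      using convex_halfspace_le[of "\<chi> k. a k" b] by (simp add: inner_vec_def)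
    ultimately show ?thesis
      using halfspace[of "\<lambda>_. 1" 1] by (auto intro!: convex_Int convex_INT)
  qed
  moreover have "- (\<chi> i. real (q $ i)) \<in> ?C"
    using N by (simp add: N_def sum_negf algebra_simps)
  moreover have "axis j 1 \<in> ?C" for j
    using N by (simp add: ax) (simp add: axis_def)
  ultimately have "simplex_1q q \<subseteq> ?C"
    unfolding simplex_1q_def by (intro hull_minimal) auto
  then show "x \<in> simplex_1q q \<Longrightarrow> ?R x"
    by blast
  assume R: "?R x"
  define s where "s = (\<Sum>i\<in>UNIV. x $ i)"
  define l where "l i = (N * x $ i + real (q $ i) * (1 - s)) / N" for i
  have l: "l i = x $ i + real (q $ i) * ((1 - s) / N)" for i
    using N by (simp add: l_def field_simps)
  have "((1 - s) / N) *\<^sub>R (- (\<chi> i. real (q $ i))) + (\<Sum>i\<in>UNIV. l i *\<^sub>R axis i 1) \<in> simplex_1q q"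
  proof (rule convex_combination_insert)
    have "(\<Sum>i\<in>UNIV. l i) = s + (N - 1) * ((1 - s) / N)"
      by (simp only: l sum.distrib sum_distrib_right[symmetric]) (simp add: N_def s_def)
    then show "(1 - s) / N + (\<Sum>i\<in>UNIV. l i) = 1"
      using N by (simp add: field_simps)
    show "0 \<le> l i" for i
      using R N by (simp add: l_def s_def)
  qed (use R N in \<open>auto simp: simplex_1q_def s_def intro: hull_inc\<close>)
  also have "((1 - s) / N) *\<^sub>R (- (\<chi> i. real (q $ i))) + (\<Sum>i\<in>UNIV. l i *\<^sub>R axis i 1) = x"
    by (simp add: vec_eq_iff l axis_def if_distrib cong: if_cong)
  finally show "x \<in> simplex_1q q" .
qed

text \<open>The strict facet inequalities cut out an open subset of the simplex, which contains the
  origin because all weights are positive.\<close>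

lemma aff_dim_simplex_1q:
  fixes q :: "nat ^ 'n"
  assumes "\<And>i. q $ i > 0"
  shows "aff_dim (simplex_1q q) = int CARD('n)"
proof -
  define N where "N = 1 + (\<Sum>i\<in>UNIV. real (q $ i))"
  let ?U = "{x :: real ^ 'n. (\<Sum>i\<in>UNIV. x $ i) < 1 \<and>
    (\<forall>i. 0 < N * x $ i + real (q $ i) * (1 - (\<Sum>i\<in>UNIV. x $ i)))}"
  have "open ?U"
    unfolding Collect_conj_eq Collect_all_eq
    by (intro open_Int open_INT ballI finite open_Collect_less continuous_intros)
  moreover have "0 \<in> ?U"
    using assms by simp
  moreover have "?U \<subseteq> simplex_1q q"
    by (auto simp: mem_simplex_1q_iff N_def less_imp_le)
  ultimately have "interior (simplex_1q q) \<noteq> {}"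
    using interiorI by blast
  then show ?thesis
    by (simp add: aff_dim_nonempty_interior)
qed

text \<open>Pairing y with the vertices gives y_i <= 1 and -(sum of q_i y_i) <= 1. The listed points
  are those where all but one of these are tight; here \<open>1\<close> is the all-ones vector. The
  barycentric coordinates of y are the slacks, scaled: q_i (1 - y_i) / N, and (1 + sum of q_i y_i) /
  N for the vertex \<open>1\<close>.\<close>

lemma polar_body_simplex_1q:
  fixes q :: "nat ^ 'n"
  assumes q: "\<And>i. q $ i > 0"
  defines "N \<equiv> 1 + (\<Sum>i\<in>UNIV. real (q $ i))"
  shows "polar_body (simplex_1q q) =
    convex hull (insert 1 (range (\<lambda>i. 1 - axis i (N / real (q $ i)))))"
    (is "_ = ?H")
proof (intro equalityI subsetI)
  have N: "N \<ge> 1"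
    by (simp add: N_def sum_nonneg)
  fix y assume y: "y \<in> polar_body (simplex_1q q)"
  have y1: "y $ i \<le> 1" for i
  proof -
    have "axis i 1 \<in> simplex_1q q"
      by (auto simp: simplex_1q_def intro: hull_inc)
    with y have "y \<bullet> axis i 1 \<le> 1"
      by (auto simp: polar_body_def)
    then show ?thesis
      by (simp add: inner_axis)
  qed
  have "- (\<chi> i. real (q $ i)) \<in> simplex_1q q"
    by (auto simp: simplex_1q_def intro: hull_inc)
  with y have "y \<bullet> (- (\<chi> i. real (q $ i))) \<le> 1"
    unfolding polar_body_def by blast
  then have yq: "- (\<Sum>i\<in>UNIV. y $ i * real (q $ i)) \<le> 1"
    by (simp add: inner_vec_def sum_negf)
  define l where "l i = real (q $ i) * (1 - y $ i) / N" for i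
  have suml: "(\<Sum>i\<in>UNIV. l i) = (N - 1 - (\<Sum>i\<in>UNIV. y $ i * real (q $ i))) / N"
    by (simp add: l_def N_def right_diff_distrib sum_subtractf mult.commute flip: sum_divide_distrib)
  have "(1 - (\<Sum>i\<in>UNIV. l i)) *\<^sub>R 1 + (\<Sum>i\<in>UNIV. l i *\<^sub>R (1 - axis i (N / real (q $ i)))) \<in> ?H"
  proof (rule convex_combination_insert)
    show "0 \<le> 1 - (\<Sum>i\<in>UNIV. l i)"
      using yq N by (simp add: suml field_simps)
    show "0 \<le> l i" for i
      using y1[of i] N by (simp add: l_def)
  qed (auto intro: hull_inc)
  also have "(1 - (\<Sum>i\<in>UNIV. l i)) *\<^sub>R 1 + (\<Sum>i\<in>UNIV. l i *\<^sub>R (1 - axis i (N / real (q $ i)))) = y"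
  proof (subst vec_eq_iff, intro allI)
    fix j
    have "l j * (N / real (q $ j)) = 1 - y $ j"
      using q[of j] N by (simp add: l_def)
    moreover have "(\<Sum>i\<in>UNIV. l i *\<^sub>R (1 - axis i (N / real (q $ i)))) $ j =
        (\<Sum>i\<in>UNIV. l i) - (\<Sum>i\<in>UNIV. if i = j then l i * (N / real (q $ i)) else 0)"
      unfolding sum_subtractf[symmetric] sum_component
      by (rule sum.cong) (auto simp: axis_def right_diff_distrib)
    ultimately show "((1 - (\<Sum>i\<in>UNIV. l i)) *\<^sub>R 1 +
        (\<Sum>i\<in>UNIV. l i *\<^sub>R (1 - axis i (N / real (q $ i))))) $ j = y $ j"
      by simp
  qed
  finally show "y \<in> ?H" .
next
  have N: "N \<ge> 1"
    by (simp add: N_def sum_nonneg)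
  have cvx: "convex (polar_body (simplex_1q q))"
  proof -
    have "polar_body P = (\<Inter>x\<in>P. {y. x \<bullet> y \<le> 1})" for P :: "(real ^ 'n) set"
      by (auto simp: polar_body_def inner_commute)
    then show ?thesis
      by (simp add: convex_INT convex_halfspace_le)
  qed
  have polI: "y \<in> polar_body (simplex_1q q)"
    if "\<And>i. y $ i \<le> 1" "- (\<Sum>i\<in>UNIV. y $ i * real (q $ i)) \<le> 1" for y
  proof -
    have "simplex_1q q \<subseteq> {x. y \<bullet> x \<le> 1}"
      unfolding simplex_1q_def using that
      by (intro hull_minimal convex_halfspace_le) (auto simp: inner_axis, simp add: inner_vec_def sum_negf)
    then show ?thesis
      by (auto simp: polar_body_def)
  qed
  have "1 \<in> polar_body (simplex_1q q)"
    by (rule polI) (auto simp: sum_nonneg intro: order_trans[of _ 0])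
  moreover have "1 - axis i (N / real (q $ i)) \<in> polar_body (simplex_1q q)" for i
  proof (rule polI)
    show "(1 - axis i (N / real (q $ i))) $ j \<le> 1" for j
      using N by (simp add: axis_def)
    have "(\<Sum>j\<in>UNIV. (1 - axis i (N / real (q $ i))) $ j * real (q $ j)) = N - 1 - N"
      using q[of i]
      by (simp add: axis_def left_diff_distrib sum_subtractf N_def if_distrib [of "\<lambda>u. u * _"] cong: if_cong)
    then show "- (\<Sum>j\<in>UNIV. (1 - axis i (N / real (q $ i))) $ j * real (q $ j)) \<le> 1"
      by simp
  qed
  ultimately have "?H \<subseteq> polar_body (simplex_1q q)"
    using cvx by (intro hull_minimal) auto
  then show "y \<in> polar_body (simplex_1q q)" if "y \<in> ?H" for y
    using that by blast
qed

lemma lattice_polytope_simplex_1q: "lattice_polytope (simplex_1q q)"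
  unfolding simplex_1q_def
  by (rule lattice_polytope_convex_hull) (auto simp: int_lattice_def axis_def)

text \<open>The polar vertices have all entries 1 except for one entry 1 - N / q_i, which the
  divisibility makes an integer.\<close>

lemma reflexive_simplex_1q:
  fixes q :: "nat ^ 'n"
  assumes q: "\<And>i. q $ i > 0" and dvd: "\<And>i. q $ i dvd 1 + (\<Sum>i\<in>UNIV. q $ i)"
  shows "reflexive_polytope (simplex_1q q)"
proof -
  have "(1 + (\<Sum>i\<in>UNIV. real (q $ i))) / real (q $ j) \<in> \<int>" for j
  proof -
    obtain k where "1 + (\<Sum>i\<in>UNIV. q $ i) = q $ j * k"
      using dvd[of j] unfolding dvd_def by blast
    then have "real (1 + (\<Sum>i\<in>UNIV. q $ i)) = real (q $ j * k)"
      by (rule arg_cong)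
    then have "1 + (\<Sum>i\<in>UNIV. real (q $ i)) = real (q $ j) * real k"
      by simp
    then show ?thesis
      using q[of j] by simp
  qed
  then have "lattice_polytope (polar_body (simplex_1q q))"
    unfolding polar_body_simplex_1q[OF q]
    by (intro lattice_polytope_convex_hull) (auto simp: int_lattice_def axis_def)
  then show ?thesis
    by (simp add: reflexive_polytope_def lattice_polytope_simplex_1q)
qed

section \<open>Lattice points of the dilates\<close>

lemma mem_dilated_simplex_1q_iff:
  fixes q :: "nat ^ 'n" and t :: nat
  defines "N \<equiv> 1 + (\<Sum>i\<in>UNIV. real (q $ i))"
  shows "x \<in> (\<lambda>x. real t *\<^sub>R x) ` simplex_1q q \<longleftrightarrow>
    (\<Sum>i\<in>UNIV. x $ i) \<le> real t \<and>
    (\<forall>i. 0 \<le> N * x $ i + real (q $ i) * (real t - (\<Sum>i\<in>UNIV. x $ i)))"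
    (is "_ \<longleftrightarrow> ?R")
proof (cases "t = 0")
  case True
  \<comment> \<open>Rescaling by 1 / t is impossible here. Adding the inequalities over all i gives
    N s - (N - 1) s = s >= 0, so s = 0. Then every coordinate is nonnegative, and their sum is
    zero.\<close>
  have "x = 0" if R: ?R
  proof -
    define s where "s = (\<Sum>i\<in>UNIV. x $ i)"
    have nn: "\<And>i. 0 \<le> N * x $ i + real (q $ i) * (- s)" and "s \<le> 0"
      using R True by (auto simp: s_def)
    have "0 \<le> (\<Sum>i\<in>UNIV. N * x $ i + real (q $ i) * (- s))"
      by (intro sum_nonneg nn)
    also have "\<dots> = N * s + (\<Sum>i\<in>UNIV. real (q $ i)) * (- s)"
      by (simp only: sum.distrib sum_distrib_left[symmetric] sum_distrib_right[symmetric] s_def)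
    also have "\<dots> = s"
      by (simp add: N_def algebra_simps)
    finally have "s = 0"
      using \<open>s \<le> 0\<close> by simp
    moreover have "N > 0"
      by (simp add: N_def sum_nonneg add_pos_nonneg)
    ultimately have "0 \<le> x $ i" for i
      using nn[of i] by (simp add: zero_le_mult_iff)
    then have "x $ i = 0" for i
      using \<open>s = 0\<close> by (simp add: s_def sum_nonneg_eq_0_iff)
    then show ?thesis
      by (simp add: vec_eq_iff)
  qed
  moreover have "simplex_1q q \<noteq> {}"
    by (simp add: simplex_1q_def)
  ultimately show ?thesis
    using True by auto
next
  case False
  then have t: "real t > 0"
    by simp
  have "x \<in> (\<lambda>x. real t *\<^sub>R x) ` simplex_1q q \<longleftrightarrow> (1 / real t) *\<^sub>R x \<in> simplex_1q q"
    using t by (force simp: image_iff)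
  also have "\<dots> \<longleftrightarrow> ?R"
  proof -
    define s where "s = (\<Sum>i\<in>UNIV. x $ i)"
    have s: "(\<Sum>i\<in>UNIV. ((1 / real t) *\<^sub>R x) $ i) = s / real t"
      by (simp add: s_def flip: sum_divide_distrib)
    have "0 \<le> N * ((1 / real t) *\<^sub>R x) $ i + real (q $ i) * (1 - s / real t) \<longleftrightarrow>
        0 \<le> N * x $ i + real (q $ i) * (real t - s)" for i
    proof -
      have "N * ((1 / real t) *\<^sub>R x) $ i + real (q $ i) * (1 - s / real t) =
          (N * x $ i + real (q $ i) * (real t - s)) / real t"
        using t by (simp add: field_simps)
      then show ?thesis
        using t by (simp add: zero_le_divide_iff)
    qed
    then show ?thesis
      unfolding mem_simplex_1q_iff N_def[symmetric] s s_def[symmetric] using t by simp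
  qed
  finally show ?thesis .
qed

text \<open>After division by 2^n the condition reads -X <= m / 2^e, and since X is an integer the
  right side may be rounded down. This turns the facet inequality of weight 2^(n - e) into
  nonnegativity of y_i.\<close>

lemma scaled_nonneg_iff_floor:
  assumes "e \<le> n"
  shows "0 \<le> 2 ^ n * real_of_int X + 2 ^ (n - e) * real m \<longleftrightarrow> 0 \<le> X + int (m div 2 ^ e)"
proof -
  have "2 ^ n * real_of_int X + 2 ^ (n - e) * real m = 2 ^ n * (real_of_int X + real m / 2 ^ e)"
    using assms by (simp add: power_diff algebra_simps)
  moreover have "(0::real) < 2 ^ n"
    by simp
  ultimately have "0 \<le> 2 ^ n * real_of_int X + 2 ^ (n - e) * real m \<longleftrightarrow>
      real_of_int (- X) \<le> real m / 2 ^ e"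
    by (simp only: zero_le_mult_iff) linarith
  also have "\<dots> \<longleftrightarrow> - X \<le> \<lfloor>real m / real (2 ^ e)\<rfloor>"
    by (simp add: le_floor_iff)
  also have "\<dots> \<longleftrightarrow> 0 \<le> X + int (m div 2 ^ e)"
    by (simp only: floor_divide_of_nat_eq) linarith
  finally show ?thesis .
qed

text \<open>The exponent \<open>e i\<close> is the \<open>k\<close> with \<open>q\<^sub>i / N = 1 / 2\<^sup>k\<close>. In the list \<open>l\<close> counted on the
  right, entry \<open>0\<close> is the quotient \<open>c\<close> and entry \<open>e i\<close> is \<open>y\<^sub>i\<close>.\<close>

lemma card_lattice_points:
  fixes e :: "'n::finite \<Rightarrow> nat" and q :: "nat ^ 'n"
  assumes e: "bij_betw e UNIV {1..n}" and q: "\<And>i. q $ i = 2 ^ (n - e i)"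
  shows "card ((\<lambda>x. real t *\<^sub>R x) ` simplex_1q q \<inter> int_lattice) =
    (\<Sum>b<2 ^ n. card {l. length l = Suc n \<and> sum_list l + supp2 b = t})"
proof -
  define A where "A = (\<lambda>x. real t *\<^sub>R x) ` simplex_1q q \<inter> int_lattice"
  define L where "L b = {l. length l = Suc n \<and> sum_list l + supp2 b = t}" for b
  \<comment> \<open>\<open>M\<close> rebuilds m = 2^n c + b from the residue b and the list entry c,
    and \<open>g\<close> solves y_i = x_i + floor(m / 2^(e i)) for x_i.\<close>
  define M where "M p = 2 ^ n * (snd p ! 0) + fst p" for p :: "nat \<times> nat list"
  define g :: "nat \<times> nat list \<Rightarrow> real ^ 'n" where
    "g p = (\<chi> i. real (snd p ! e i) - real (M p div 2 ^ e i))" for p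
  let ?B = "SIGMA b:{..<2 ^ n}. L b"
  have e_range: "1 \<le> e i" "e i \<le> n" for i
    using bij_betwE[OF e] by auto
  have e_sum: "(\<Sum>i\<in>UNIV. f (e i)) = (\<Sum>j=1..n. f j)" for f :: "nat \<Rightarrow> nat"
    by (rule sum.reindex_bij_betw[OF e])
  have N: "1 + (\<Sum>i\<in>UNIV. real (q $ i)) = 2 ^ n"
  proof -
    have "(\<Sum>i\<in>UNIV. q $ i) = (\<Sum>j=1..n. 2 ^ (n - j))"
      unfolding q by (rule e_sum)
    also have "\<dots> = (\<Sum>j<n. 2 ^ j)"
      by (rule sum.reindex_bij_witness[of _ "\<lambda>j. n - j" "\<lambda>j. n - j"]) auto
    finally have "1 + (\<Sum>i\<in>UNIV. q $ i) = 2 ^ n"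
      by (simp add: sum_powers_of_2)
    then have "real (1 + (\<Sum>i\<in>UNIV. q $ i)) = real (2 ^ n)"
      by (rule arg_cong)
    then show ?thesis
      by simp
  qed
  have list_sum: "sum_list l = l ! 0 + (\<Sum>i\<in>UNIV. l ! e i)" if "length l = Suc n" for l :: "nat list"
  proof -
    have "sum_list l = (\<Sum>j=0..n. l ! j)"
      using that by (simp add: sum_list_sum_nth atLeastLessThanSuc_atLeastAtMost)
    also have "\<dots> = l ! 0 + (\<Sum>j=1..n. l ! j)"
      by (simp add: sum.atLeast_Suc_atMost)
    finally show ?thesis
      by (simp add: e_sum[of "\<lambda>j. l ! j"])
  qed
  have digits: "(\<Sum>i\<in>UNIV. m div 2 ^ e i) + supp2 (m mod 2 ^ n) + m div 2 ^ n = m" for m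
    using legendre_digits[where n = n and m = m] by (simp add: e_sum[of "\<lambda>j. m div 2 ^ j"])
  \<comment> \<open>The slack m = t - (sum of x_i) is a natural number at lattice points of the
    dilate. Naming it lets the facet inequalities be rounded to floor conditions.\<close>
  have A_iff: "x \<in> A \<longleftrightarrow> x \<in> int_lattice \<and> (\<exists>m. (\<Sum>i\<in>UNIV. x $ i) + real m = real t \<and>
      (\<forall>i. 0 \<le> \<lfloor>x $ i\<rfloor> + int (m div 2 ^ e i)))" (is "_ \<longleftrightarrow> _ \<and> ?R x") for x
  proof (cases "x \<in> int_lattice")
    case True
    then have x: "x $ i = real_of_int \<lfloor>x $ i\<rfloor>" for i
      by (simp add: int_lattice_def)
    define s where "s = (\<Sum>i\<in>UNIV. x $ i)"
    have s: "s = real_of_int (\<Sum>i\<in>UNIV. \<lfloor>x $ i\<rfloor>)"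
      unfolding s_def of_int_sum by (rule sum.cong) (rule refl x)+
    have "x \<in> A \<longleftrightarrow> s \<le> real t \<and> (\<forall>i. 0 \<le> 2 ^ n * x $ i + 2 ^ (n - e i) * (real t - s))"
      unfolding A_def Int_iff mem_dilated_simplex_1q_iff N s_def using True by (simp add: q)
    also have "\<dots> \<longleftrightarrow> (\<exists>m. s + real m = real t \<and>
        (\<forall>i. 0 \<le> 2 ^ n * real_of_int \<lfloor>x $ i\<rfloor> + 2 ^ (n - e i) * real m))"
    proof
      assume *: "s \<le> real t \<and> (\<forall>i. 0 \<le> 2 ^ n * x $ i + 2 ^ (n - e i) * (real t - s))"
      define m where "m = nat (int t - (\<Sum>i\<in>UNIV. \<lfloor>x $ i\<rfloor>))"
      have "(\<Sum>i\<in>UNIV. \<lfloor>x $ i\<rfloor>) \<le> int t"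
        using * s by linarith
      then have "real m = real t - s"
        by (simp add: m_def s)
      with * show "\<exists>m. s + real m = real t \<and>
        (\<forall>i. 0 \<le> 2 ^ n * real_of_int \<lfloor>x $ i\<rfloor> + 2 ^ (n - e i) * real m)"
        by (intro exI[of _ m]) (simp flip: x)
    next
      assume "\<exists>m. s + real m = real t \<and>
        (\<forall>i. 0 \<le> 2 ^ n * real_of_int \<lfloor>x $ i\<rfloor> + 2 ^ (n - e i) * real m)"
      then obtain m where m: "s + real m = real t"
        and "\<forall>i. 0 \<le> 2 ^ n * real_of_int \<lfloor>x $ i\<rfloor> + 2 ^ (n - e i) * real m"
        by blast
      moreover from m have "real m = real t - s"
        by linarith
      ultimately show "s \<le> real t \<and> (\<forall>i. 0 \<le> 2 ^ n * x $ i + 2 ^ (n - e i) * (real t - s))"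
        by (simp flip: x) 
    qed
    also have "\<dots> \<longleftrightarrow> ?R x"
      by (simp only: scaled_nonneg_iff_floor[OF e_range(2)] s_def)
    finally show ?thesis
      using True by simp
  qed (simp add: A_def)
  have M_divmod: "M (b, l) mod 2 ^ n = b" "M (b, l) div 2 ^ n = l ! 0" if "b < 2 ^ n" for b l
    using that by (simp_all add: M_def)
  \<comment> \<open>Subtracting Legendre's formula for \<open>M (b, l)\<close> from the equation
    defining \<open>L b\<close> cancels both \<open>supp2 b\<close> and the entry
    \<open>l ! 0\<close>.\<close>
  have g_sum: "(\<Sum>i\<in>UNIV. g (b, l) $ i) + real (M (b, l)) = real t"
    if "b < 2 ^ n" "l \<in> L b" for b l
  proof -
    have "(\<Sum>i\<in>UNIV. g (b, l) $ i) =
        real (\<Sum>i\<in>UNIV. l ! e i) - real (\<Sum>i\<in>UNIV. M (b, l) div 2 ^ e i)"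
      by (simp add: g_def sum_subtractf)
    moreover have "l ! 0 + (\<Sum>i\<in>UNIV. l ! e i) + supp2 b = t"
      using that(2) list_sum[of l] unfolding L_def by auto
    moreover have "(\<Sum>i\<in>UNIV. M (b, l) div 2 ^ e i) + supp2 b + l ! 0 = M (b, l)"
      using digits[of "M (b, l)"] by (simp only: M_divmod[OF that(1)])
    ultimately show ?thesis
      by linarith
  qed
  have "bij_betw g ?B A"
  proof (rule bij_betw_imageI)
    show "inj_on g ?B"
    proof (rule inj_onI, clarsimp)
      fix b l b' l'
      assume bl: "b < 2 ^ n" "l \<in> L b" "b' < 2 ^ n" "l' \<in> L b'" and eq: "g (b, l) = g (b', l')"
      \<comment> \<open>By \<open>g_sum\<close> the coordinate sum of the image determines
        \<open>M\<close>, hence b and entry 0 by division with remainder. The single coordinates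
        then give the other entries.\<close>
      have M: "M (b, l) = M (b', l')"
        using g_sum[OF bl(1,2)] g_sum[OF bl(3,4)] eq by simp
      then have b: "b = b'" and l0: "l ! 0 = l' ! 0"
        using M_divmod[OF bl(1)] M_divmod[OF bl(3)] by metis+
      have le: "l ! e i = l' ! e i" for i
        using arg_cong[OF eq, of "\<lambda>x. x $ i"] M by (simp add: g_def)
      have "l ! j = l' ! j" if "j < Suc n" for j
      proof (cases "j = 0")
        case False
        then have "j \<in> range e"
          using that bij_betw_imp_surj_on[OF e] by simp
        then obtain i where "j = e i"
          by blast
        with le show ?thesis by simp
      qed (simp add: l0)
      then show "b = b' \<and> l = l'"
        using bl b by (auto simp: L_def intro: nth_equalityI)
    qed
    show "g ` ?B = A"
    proof (intro equalityI subsetI)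
      fix x assume "x \<in> g ` ?B"
      then obtain b l where bl: "b < 2 ^ n" "l \<in> L b" and x: "x = g (b, l)"
        by auto
      have fl: "\<lfloor>x $ i\<rfloor> = int (l ! e i) - int (M (b, l) div 2 ^ e i)" for i
        unfolding x g_def by (simp add: floor_eq_iff)
      have "x \<in> int_lattice"
        by (simp add: x g_def int_lattice_def)
      then show "x \<in> A"
        unfolding A_iff using g_sum[OF bl] fl x by auto
    next
      fix x assume "x \<in> A"
      then obtain m where xl: "x \<in> int_lattice" and m: "(\<Sum>i\<in>UNIV. x $ i) + real m = real t"
        and nn: "\<And>i. 0 \<le> \<lfloor>x $ i\<rfloor> + int (m div 2 ^ e i)"
        unfolding A_iff by blast
      define y where "y i = nat (\<lfloor>x $ i\<rfloor> + int (m div 2 ^ e i))" for i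
      have y: "real (y i) = x $ i + real (m div 2 ^ e i)" for i
        using nn[of i] xl by (simp add: y_def int_lattice_def)
      \<comment> \<open>Position 0 is free for the quotient because e takes values in {1..n};
        \<open>inv e\<close> finds the coordinate belonging to each other position.\<close>
      define l where "l = map (\<lambda>j. if j = 0 then m div 2 ^ n else y (inv e j)) [0..<Suc n]"
      define b where "b = m mod 2 ^ n"
      have b: "b < 2 ^ n"
        by (simp add: b_def)
      have len: "length l = Suc n"
        by (simp add: l_def)
      have l0: "l ! 0 = m div 2 ^ n"
        by (simp add: l_def del: upt_Suc)
      have le: "l ! e i = y i" for i
        using e_range[of i] bij_betw_imp_inj_on[OF e] by (simp add: l_def del: upt_Suc)
      have M: "M (b, l) = m"
        by (simp add: M_def l0 b_def)
      \<comment> \<open>The computation of \<open>g_sum\<close> in reverse: Legendre's formula for m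
        reduces the list sum to t minus the digit sum of b.\<close>
      have "real (\<Sum>i\<in>UNIV. y i) = (\<Sum>i\<in>UNIV. x $ i) + real (\<Sum>i\<in>UNIV. m div 2 ^ e i)"
        by (simp add: y sum.distrib)
      moreover have "sum_list l = m div 2 ^ n + (\<Sum>i\<in>UNIV. y i)"
        by (simp add: list_sum[OF len] l0 le)
      ultimately have "sum_list l + supp2 b = t"
        using m digits[of m] unfolding b_def by linarith
      then have "(b, l) \<in> ?B"
        using b len by (simp add: L_def)
      moreover have "g (b, l) = x"
        by (simp add: g_def M le y vec_eq_iff)
      ultimately show "x \<in> g ` ?B"
        by (metis image_eqI)
    qed
  qed
  then have "card A = card ?B"
    by (simp add: bij_betw_same_card)
  also have "\<dots> = (\<Sum>b<2 ^ n. card (L b))"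
  proof (rule card_SigmaI)
    have "L b \<subseteq> {l. set l \<subseteq> {..t} \<and> length l = Suc n}" for b
      using member_le_sum_list by (fastforce simp: L_def)
    then show "\<forall>b\<in>{..<2 ^ n}. finite (L b)"
      using finite_lists_length_eq[of "{..t}" "Suc n"] finite_subset by blast
  qed simp
  finally show ?thesis
    by (simp add: A_def L_def)
qed

section \<open>From the lattice point count to the Ehrhart series\<close>

lemma inverse_one_minus_fps_X_power_nth:
  "fps_nth (inverse ((1 - fps_X) ^ Suc n :: real fps)) k =
    real (card {l :: nat list. length l = Suc n \<and> sum_list l = k})"
  \<comment> \<open>Stars and bars: both sides equal the binomial coefficient (n + k choose
    k).\<close>
  using one_minus_const_fps_X_neg_power'[of "Suc n" "1::real"]
  by (simp add: card_length_sum_list add.commute)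

lemma ehrhart_series_simplex_1q:
  fixes e :: "'n::finite \<Rightarrow> nat" and q :: "nat ^ 'n"
  assumes e: "bij_betw e UNIV {1..n}" and q: "\<And>i. q $ i = 2 ^ (n - e i)"
  shows "ehrhart_series (simplex_1q q) =
    fps_of_poly (\<Sum>b<2 ^ n. monom 1 (supp2 b)) / (1 - fps_X) ^ Suc n"
proof (rule fps_ext)
  fix t
  define F where "F = inverse ((1 - fps_X) ^ Suc n :: real fps)"
  have "fps_of_poly (\<Sum>b<2 ^ n. monom 1 (supp2 b)) / (1 - fps_X) ^ Suc n =
      fps_of_poly (\<Sum>b<2 ^ n. monom 1 (supp2 b)) * F"
    unfolding F_def by (rule fps_divide_unit) (simp add: fps_power_zeroth del: power_Suc)
  also have "\<dots> = (\<Sum>b<2 ^ n. fps_X ^ supp2 b * F)"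
    by (simp add: fps_of_poly_sum fps_of_poly_monom' sum_distrib_right)
  also have "fps_nth \<dots> t = (\<Sum>b<2 ^ n. real (card {l :: nat list. length l = Suc n \<and> sum_list l + supp2 b = t}))"
    unfolding fps_sum_nth
  proof (rule sum.cong[OF refl])
    fix b :: nat
    show "fps_nth (fps_X ^ supp2 b * F) t =
        real (card {l :: nat list. length l = Suc n \<and> sum_list l + supp2 b = t})"
    \<comment> \<open>In this case truncated subtraction would give \<open>t - supp2 b = 0\<close>
      and wrongly count the zero list, so it is treated separately.\<close>
    proof (cases "t < supp2 b")
      case True
      then have "{l :: nat list. length l = Suc n \<and> sum_list l + supp2 b = t} = {}"
        by auto
      then show ?thesis
        using True by (simp add: fps_X_power_mult_nth)
    next
      case False
      then have "{l :: nat list. length l = Suc n \<and> sum_list l + supp2 b = t} =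
          {l. length l = Suc n \<and> sum_list l = t - supp2 b}"
        by auto
      then show ?thesis
        using False
        by (simp only: fps_X_power_mult_nth F_def inverse_one_minus_fps_X_power_nth if_False)
    qed
  qed
  finally show "fps_nth (ehrhart_series (simplex_1q q)) t =
      fps_nth (fps_of_poly (\<Sum>b<2 ^ n. monom 1 (supp2 b)) / (1 - fps_X) ^ Suc n) t"
    by (simp add: ehrhart_series_def card_lattice_points[OF e q])
qed

section \<open>The binary divisor system and its simplices\<close>

theorem theorem3p6:
  fixes a d :: "nat \<Rightarrow> nat"
  assumes a: "\<And>n. a n = 2 ^ n"
    and d: "\<And>n. d n = 2 ^ (n + 1)"
  shows "numeral_system a \<and> divisor_system a d \<and>
    (\<forall>(n::nat) (ix :: 'n::finite \<Rightarrow> nat) (q :: nat ^ 'n).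
       n \<ge> 1 \<and> CARD('n) = n \<and> bij_betw ix UNIV {1..n} \<and> (\<forall>i. q $ i = 2 ^ (ix i - 1)) \<longrightarrow>
         reflexive_polytope (simplex_1q q) \<and>
         has_hstar_polynomial (simplex_1q q) (\<Sum>b = 0..2 ^ n - 1. monom 1 (supp2 b)) \<and>
         (\<Sum>b = 0..2 ^ n - 1. monom (1::real) (supp2 b)) = [:1, 1:] ^ n)"
proof (intro conjI allI impI)
  show "numeral_system a"
    by (simp add: numeral_system_def a strict_mono_def)
  \<comment> \<open>Passing to n + 1 doubles every old summand and adds a new one equal to 1. The
    identity also holds at n = 0, where the induction starts.\<close>
  have "1 + (\<Sum>i<n. real (a n) / real (d i)) = real (a n)" for n
  proof (induction n)
    case (Suc n)
    have "(\<Sum>i<n. real (a (Suc n)) / real (d i)) = 2 * (\<Sum>i<n. real (a n) / real (d i))"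
      by (simp add: a sum_distrib_left)
    also have "\<dots> = 2 * (real (a n) - 1)"
      using Suc by simp
    finally show ?case
      by (simp add: a d)
  qed (simp add: a)
  moreover have "strict_mono d"
    by (simp add: strict_mono_def d)
  moreover have "d i dvd a n" if "i < n" for i n
    unfolding a d using that by (intro le_imp_power_dvd) simp
  ultimately show "divisor_system a d"
    by (simp add: divisor_system_def d)
next
  fix n :: nat and ix :: "'n \<Rightarrow> nat" and q :: "nat ^ 'n"
  assume "n \<ge> 1 \<and> CARD('n) = n \<and> bij_betw ix UNIV {1..n} \<and> (\<forall>i. q $ i = 2 ^ (ix i - 1))"
  then have card: "CARD('n) = n" and ix: "bij_betw ix UNIV {1..n}"
    and q_ix: "\<And>i. q $ i = 2 ^ (ix i - 1)"
    by auto
  \<comment> \<open>The weights are 2^(ix i - 1), while the count uses the form 2^(n - e i). The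
    reflection j -> n + 1 - j converts one indexing into the other.\<close>
  have "bij_betw (\<lambda>j. n + 1 - j) {1..n} {1..n}"
    by (rule bij_betw_byWitness[where f' = "\<lambda>j. n + 1 - j"]) auto
  from bij_betw_trans[OF ix this] have e: "bij_betw (\<lambda>i. n + 1 - ix i) UNIV {1..n}"
    by (simp add: comp_def)
  have ix_range: "1 \<le> ix i" "ix i \<le> n" for i
    using bij_betwE[OF ix] by auto
  have q: "q $ i = 2 ^ (n - (n + 1 - ix i))" for i
  proof -
    have "ix i - 1 = n - (n + 1 - ix i)"
      using ix_range[of i] by linarith
    then show ?thesis
      by (simp only: q_ix)
  qed
  have range: "{0..2 ^ n - 1} = {..<(2::nat) ^ n}"
  proof (rule set_eqI)
    show "x \<in> {0..2 ^ n - 1} \<longleftrightarrow> x \<in> {..<2 ^ n}" for x :: nat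
      using zero_less_power[of "2::nat" n] unfolding atLeastAtMost_iff lessThan_iff by linarith
  qed
  show hpoly: "(\<Sum>b = 0..2 ^ n - 1. monom (1::real) (supp2 b)) = [:1, 1:] ^ n"
    unfolding range by (rule sum_monom_supp2)
  have pos: "q $ i > 0" for i
    by (simp add: q_ix)
  have dim: "nat (aff_dim (simplex_1q q)) = n"
    by (simp add: aff_dim_simplex_1q pos card)
  show "has_hstar_polynomial (simplex_1q q) (\<Sum>b = 0..2 ^ n - 1. monom 1 (supp2 b))"
    unfolding has_hstar_polynomial_def
  proof (intro conjI)
    show "simplex_1q q \<noteq> {}"
      by (simp add: simplex_1q_def)
    show "degree (\<Sum>b = 0..2 ^ n - 1. monom (1::real) (supp2 b)) \<le> nat (aff_dim (simplex_1q q))"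
      unfolding hpoly dim by (simp add: degree_linear_power)
    show "ehrhart_series (simplex_1q q) = fps_of_poly (\<Sum>b = 0..2 ^ n - 1. monom 1 (supp2 b)) /
        (1 - fps_X) ^ (nat (aff_dim (simplex_1q q)) + 1)"
      unfolding dim range Suc_eq_plus1[symmetric] by (rule ehrhart_series_simplex_1q[OF e q])
  qed (rule lattice_polytope_simplex_1q)
  show "reflexive_polytope (simplex_1q q)"
  proof (rule reflexive_simplex_1q[OF pos])
    have "(\<Sum>i\<in>UNIV. q $ i) = (\<Sum>j=1..n. 2 ^ (j - 1))"
      unfolding q_ix by (rule sum.reindex_bij_betw[OF ix])
    also have "\<dots> = (\<Sum>j<n. 2 ^ j)"
      by (rule sum.reindex_bij_witness[of _ Suc "\<lambda>j. j - 1"]) auto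
    finally have "1 + (\<Sum>i\<in>UNIV. q $ i) = 2 ^ n"
      by (simp add: sum_powers_of_2)
    moreover have "q $ i dvd 2 ^ n" for i
      unfolding q_ix using ix_range[of i] by (intro le_imp_power_dvd) linarith
    ultimately show "q $ i dvd 1 + (\<Sum>i\<in>UNIV. q $ i)" for i
      by (simp only:)
  qed
qed

end
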